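(* Let $A\in\mathbb R^{n\times n}$, $B\in\mathbb R^{n\times m}$, $C\in\mathbb R^{p\times n}$, let $D\in\mathbb R^{q\times n}$ with $q\le n$ have full row rank, and assume that $(A,B)$ is reachable and $(C,A)$ is observable. Let $G\in\mathbb R^{n\times p}$ be such that $A-GC$ is stable, let $r$ denote the spectral radius of $A-GC$, let $1<\rho<1/r$, and let $\Sigma_\rho$ and $\beta_\rho$ be as defined in the context. If the initial variance $P_0$ satisfies $0<P_0\le\Sigma_\rho$ and $0\le\theta\le\beta_\rho$, then the entire trajectory of the recursion $$P_{t+1}=r^\theta(P_t)=A[P_t^{-1}+C^TC-\theta D^TD]^{-1}A^T+BB^T,\qquad t\ge0,$$ satisfies $0<P_t\le\Sigma_\rho$, so $V_t=(P_t^{-1}-\theta D^TD)^{-1}>0$ for all $t$. Furthermore, for $P_0=\Sigma_\rho$ the sequence $P_t$ is monotone decreasing, i.e. $P_{t+1}\le P_t$ for all $t\ge0$.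
   Context: All matrices are real; $\ge$, $>$ denote the Loewner partial order on symmetric matrices; $\lambda_1(\cdot)$ is the largest eigenvalue. A square matrix is stable if all its eigenvalues lie strictly inside the unit circle. For $G$ with $A-GC$ stable with spectral radius $r$, and $1<\rho<1/r$ (where $1/r=\infty$ if $r=0$), $\Sigma_\rho$ is the unique solution, which is positive definite when $(A,B)$ is reachable, of the Lyapunov equation $$\Sigma_\rho=\rho^2(A-GC)\Sigma_\rho(A-GC)^T+BB^T+GG^T,$$ and $$\beta_\rho=\frac{\rho^2-1}{\rho^2\lambda_1(D\Sigma_\rho D^T)}.$$ *)

theory Defs
  imports "HOL-Analysis.Analysis"
begin

(* On real ^ 'n ^ 'n the library instances of "*", "^" and "\<le>" are componentwise. Powers and
   the Loewner order therefore get their own constants, and products are written with "**". *)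

definition mat_power :: "'a::semiring_1 ^ 'n ^ 'n \<Rightarrow> nat \<Rightarrow> 'a ^ 'n ^ 'n" where
  "mat_power A k = (((**) A) ^^ k) (mat 1)"

definition symmetric_mat :: "real ^ 'n ^ 'n \<Rightarrow> bool" where
  "symmetric_mat M \<longleftrightarrow> transpose M = M"

definition psd :: "real ^ 'n ^ 'n \<Rightarrow> bool" where
  "psd M \<longleftrightarrow> symmetric_mat M \<and> (\<forall>x. 0 \<le> x \<bullet> (M *v x))"

definition pd :: "real ^ 'n ^ 'n \<Rightarrow> bool" where
  "pd M \<longleftrightarrow> symmetric_mat M \<and> (\<forall>x. x \<noteq> 0 \<longrightarrow> 0 < x \<bullet> (M *v x))"

definition loewner_le :: "real ^ 'n ^ 'n \<Rightarrow> real ^ 'n ^ 'n \<Rightarrow> bool" (infix "\<preceq>\<^sub>L" 50) where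
  "M \<preceq>\<^sub>L N \<longleftrightarrow> symmetric_mat M \<and> symmetric_mat N \<and> psd (N - M)"

definition loewner_less :: "real ^ 'n ^ 'n \<Rightarrow> real ^ 'n ^ 'n \<Rightarrow> bool" (infix "\<prec>\<^sub>L" 50) where
  "M \<prec>\<^sub>L N \<longleftrightarrow> symmetric_mat M \<and> symmetric_mat N \<and> pd (N - M)"

definition eigenvalues :: "'a::field ^ 'n ^ 'n \<Rightarrow> 'a set" where
  "eigenvalues M = {l. \<exists>v. v \<noteq> 0 \<and> M *v v = l *s v}"

definition complex_eigenvalues :: "real ^ 'n ^ 'n \<Rightarrow> complex set" where
  "complex_eigenvalues M = eigenvalues (map_matrix complex_of_real M)"

definition spectral_radius :: "real ^ 'n ^ 'n \<Rightarrow> real" where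
  "spectral_radius M = Max (cmod ` complex_eigenvalues M)"

definition stable_mat :: "real ^ 'n ^ 'n \<Rightarrow> bool" where
  "stable_mat M \<longleftrightarrow> (\<forall>l \<in> complex_eigenvalues M. cmod l < 1)"

(* Only meaningful for symmetric M, where all eigenvalues are real. *)
definition lambda_max :: "real ^ 'n ^ 'n \<Rightarrow> real" where
  "lambda_max M = Max (eigenvalues M)"

(* The union consists of the columns of the block matrix [B, A B, ..., A^(n-1) B], so the
   condition says that this reachability matrix has rank n. *)
definition reachable :: "real ^ 'n ^ 'n \<Rightarrow> real ^ 'm ^ 'n \<Rightarrow> bool" where
  "reachable A B \<longleftrightarrow>
     dim (\<Union>k \<in> {..<CARD('n)}. columns (mat_power A k ** B)) = CARD('n)"

(* Likewise with the rows of the observability matrix, obtained by stacking C, C A, ..., C A^(n-1). *)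
definition observable :: "real ^ 'n ^ 'p \<Rightarrow> real ^ 'n ^ 'n \<Rightarrow> bool" where
  "observable C A \<longleftrightarrow>
     dim (\<Union>k \<in> {..<CARD('n)}. rows (C ** mat_power A k)) = CARD('n)"

definition Sigma_rho ::
  "real ^ 'n ^ 'n \<Rightarrow> real ^ 'm ^ 'n \<Rightarrow> real ^ 'n ^ 'p \<Rightarrow> real ^ 'p ^ 'n \<Rightarrow> real \<Rightarrow> real ^ 'n ^ 'n" where
  "Sigma_rho A B C G \<rho> =
     (THE S. S = \<rho>\<^sup>2 *\<^sub>R ((A - G ** C) ** S ** transpose (A - G ** C))
                   + B ** transpose B + G ** transpose G)"

definition beta_rho ::
  "real ^ 'n ^ 'n \<Rightarrow> real ^ 'm ^ 'n \<Rightarrow> real ^ 'n ^ 'p \<Rightarrow> real ^ 'n ^ 'q \<Rightarrow> real ^ 'p ^ 'n \<Rightarrow> real \<Rightarrow> real" where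
  "beta_rho A B C D G \<rho> =
     (\<rho>\<^sup>2 - 1) / (\<rho>\<^sup>2 * lambda_max (D ** Sigma_rho A B C G \<rho> ** transpose D))"

(* matrix_inv is unspecified on singular matrices. *)
definition risk_riccati ::
  "real ^ 'n ^ 'n \<Rightarrow> real ^ 'm ^ 'n \<Rightarrow> real ^ 'n ^ 'p \<Rightarrow> real ^ 'n ^ 'q \<Rightarrow> real
    \<Rightarrow> real ^ 'n ^ 'n \<Rightarrow> real ^ 'n ^ 'n" where
  "risk_riccati A B C D \<theta> P =
     A ** matrix_inv (matrix_inv P + transpose C ** C - \<theta> *\<^sub>R (transpose D ** D)) ** transpose A
       + B ** transpose B"

end

theory Submission
  imports Defs "HOL-Complex_Analysis.Complex_Analysis"
begin

text \<open>
  Write \<open>F = A - G C\<close>, \<open>S = \<Sigma>\<^sub>\<rho>\<close> and \<open>W = P\<^sup>-\<^sup>1 - \<theta> D\<^sup>T D\<close>, so that one step of the recursion is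
  \<open>P \<mapsto> A (W + C\<^sup>T C)\<^sup>-\<^sup>1 A\<^sup>T + B B\<^sup>T\<close>. The matrix \<open>S\<close> is an upper barrier for the recursion, for two
  reasons.

  The number \<open>\<beta>\<^sub>\<rho>\<close> is chosen such that \<open>\<theta> D\<^sup>T D \<le> (1 - \<rho>\<^sup>-\<^sup>2) S\<^sup>-\<^sup>1\<close> for all \<open>\<theta> \<le> \<beta>\<^sub>\<rho>\<close>
  (\<open>gram_le_lambda_max_inverse\<close>). If \<open>0 < P \<le> S\<close>, then \<open>P\<^sup>-\<^sup>1 \<ge> S\<^sup>-\<^sup>1\<close>, hence \<open>W \<ge> \<rho>\<^sup>-\<^sup>2 S\<^sup>-\<^sup>1 > 0\<close>: the
  recursion is well defined at \<open>P\<close>, and \<open>W\<^sup>-\<^sup>1 \<le> \<rho>\<^sup>2 S\<close> (\<open>riccati_information_bounds\<close>).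

  The Riccati step uses the optimal filter gain, so replacing that gain by \<open>G\<close> can only increase the
  variance: \<open>A (W + C\<^sup>T C)\<^sup>-\<^sup>1 A\<^sup>T \<le> F W\<^sup>-\<^sup>1 F\<^sup>T + G G\<^sup>T\<close> (\<open>innovation_form_le\<close>). Together,
  \<open>r\<^sup>\<theta>(P) \<le> \<rho>\<^sup>2 F S F\<^sup>T + G G\<^sup>T + B B\<^sup>T = S\<close> (\<open>risk_riccati_le\<close>). Reachability makes the new iterate
  positive definite even if \<open>A\<close> is singular (\<open>pd_risk_riccati\<close>), so the induction goes on. Since the
  step is monotone, \<open>P\<^sub>1 \<le> P\<^sub>0 = S\<close> propagates to \<open>P\<^sub>t\<^sub>+\<^sub>1 \<le> P\<^sub>t\<close>.

  Every Loewner inequality between inverses comes from the variational formula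
  \<open>y\<^sup>T M\<^sup>-\<^sup>1 y = max\<^sub>z (2 y\<^sup>T z - z\<^sup>T M z)\<close> (\<open>inverse_form_ge\<close>, \<open>inverse_form_attained\<close>); this avoids
  matrix square roots and the matrix inversion lemma.

  That the Lyapunov equation has exactly one solution, and that this solution is positive definite,
  rests on \<open>(\<rho> F\<^sup>T)\<^sup>k \<rightarrow> 0\<close> (\<open>scaled_powers_tendsto_0\<close>). This holds because the map
  \<open>z \<mapsto> (I - z F)\<^sup>-\<^sup>1\<close> is holomorphic in a disc around 0 that contains \<open>\<rho>\<close>, its radius being the
  inverse of the spectral radius of \<open>F\<close>, and has the powers of \<open>F\<close> as Taylor coefficients.
\<close>

(* The transpose is kept visible: the default simplification turns it into a row-vector product. *)
declare transpose_matrix_vector [simp del]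

(* The dollar sign denotes vector components throughout, never power series coefficients. *)
unbundle no fps_syntax

section \<open>Quadratic forms\<close>

lemma inner_transpose_mult:
  fixes A :: "real ^ 'n ^ 'm"
  shows "(transpose A *v x) \<bullet> y = x \<bullet> (A *v y)"
  by (simp add: transpose_matrix_vector dot_lmul_matrix)

lemma inner_mult_swap:
  fixes M :: "real ^ 'n ^ 'n"
  assumes "symmetric_mat M"
  shows "x \<bullet> (M *v y) = (M *v x) \<bullet> y"
  using assms inner_transpose_mult[of M x y] by (simp add: symmetric_mat_def)

lemma scaleR_mult_vec:
  fixes M :: "real ^ 'n ^ 'm"
  shows "(c *\<^sub>R M) *v x = c *\<^sub>R (M *v x)"
  by (simp add: scaleR_matrix_vector_assoc)

lemma form_gram:
  fixes C :: "real ^ 'n ^ 'm"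
  shows "x \<bullet> ((transpose C ** C) *v x) = (C *v x) \<bullet> (C *v x)"
  by (metis inner_commute inner_transpose_mult matrix_vector_mul_assoc)

lemma form_cogram:
  fixes B :: "real ^ 'm ^ 'n"
  shows "x \<bullet> ((B ** transpose B) *v x) = (transpose B *v x) \<bullet> (transpose B *v x)"
  using form_gram[of x "transpose B"] by simp

lemma inner_congruence:
  fixes F :: "real ^ 'n ^ 'm"
  shows "x \<bullet> ((F ** S ** transpose F) *v y) = (transpose F *v x) \<bullet> (S *v (transpose F *v y))"
  by (simp add: inner_transpose_mult flip: matrix_vector_mul_assoc)

lemma transpose_plus: "transpose (M + N) = transpose M + transpose N"
  by (simp add: transpose_def vec_eq_iff)

lemma transpose_minus: "transpose (M - N) = transpose M - transpose N"
  by (simp add: transpose_def vec_eq_iff)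

lemma symmetric_mat_add: "symmetric_mat M \<Longrightarrow> symmetric_mat N \<Longrightarrow> symmetric_mat (M + N)"
  by (simp add: symmetric_mat_def transpose_plus)

lemma symmetric_mat_diff: "symmetric_mat M \<Longrightarrow> symmetric_mat N \<Longrightarrow> symmetric_mat (M - N)"
  by (simp add: symmetric_mat_def transpose_minus)

lemma symmetric_mat_scaleR: "symmetric_mat M \<Longrightarrow> symmetric_mat (c *\<^sub>R M)"
  by (simp add: symmetric_mat_def transpose_scalar)

lemma symmetric_mat_zero: "symmetric_mat 0"
  by (simp add: symmetric_mat_def transpose_def vec_eq_iff)

lemma symmetric_mat_gram: "symmetric_mat (transpose C ** C)"
  by (simp add: symmetric_mat_def matrix_transpose_mul)

lemma symmetric_mat_cogram: "symmetric_mat (B ** transpose B)"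
  by (simp add: symmetric_mat_def matrix_transpose_mul)

lemma symmetric_mat_congruence: "symmetric_mat S \<Longrightarrow> symmetric_mat (F ** S ** transpose F)"
  by (simp add: symmetric_mat_def matrix_transpose_mul matrix_mul_assoc)

lemma loewner_le_iff_form:
  "M \<preceq>\<^sub>L N \<longleftrightarrow> symmetric_mat M \<and> symmetric_mat N \<and> (\<forall>x. x \<bullet> (M *v x) \<le> x \<bullet> (N *v x))"
  by (auto simp: loewner_le_def psd_def symmetric_mat_diff matrix_vector_mult_diff_rdistrib inner_diff_right)

lemma loewner_less_zero_iff: "0 \<prec>\<^sub>L M \<longleftrightarrow> pd M"
  by (auto simp: loewner_less_def symmetric_mat_zero pd_def)

lemma pd_nonneg: "pd M \<Longrightarrow> 0 \<le> x \<bullet> (M *v x)"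
  by (cases "x = 0") (auto simp: pd_def less_imp_le)

text \<open>
  A zero of a nonnegative quadratic form is a minimum, so the gradient vanishes there. Concretely, the
  form at \<open>x - t M x\<close> would be negative for small \<open>t > 0\<close> if \<open>M x\<close> were nonzero.
\<close>

lemma psd_form_eq_0_imp:
  assumes "psd M" and "x \<bullet> (M *v x) = 0"
  shows "M *v x = 0"
proof (rule ccontr)
  define w where "w = M *v x"
  assume "M *v x \<noteq> 0"
  then have pos: "0 < w \<bullet> w" by (simp add: w_def)
  have nn: "0 \<le> w \<bullet> (M *v w)" using assms by (simp add: psd_def)
  define c where "c = w \<bullet> (M *v w)"
  (* The summand 1 keeps the step positive also when c = 0. *)
  define t where "t = w \<bullet> w / (c + 1)"
  have sym: "symmetric_mat M" using assms by (simp add: psd_def)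
  have "0 \<le> (x - t *\<^sub>R w) \<bullet> (M *v (x - t *\<^sub>R w))"
    using assms by (simp add: psd_def)
  also have "\<dots> = - 2 * t * (w \<bullet> w) + t\<^sup>2 * c"
    using assms(2) inner_mult_swap[OF sym, of x w]
    by (simp add: matrix_vector_mult_diff_distrib matrix_vector_mult_scaleR inner_diff_left inner_diff_right
        w_def[symmetric] c_def algebra_simps power2_eq_square)
  also have "\<dots> = t * (t * c - 2 * (w \<bullet> w))" by (simp add: algebra_simps power2_eq_square)
  finally have "0 \<le> t * (t * c - 2 * (w \<bullet> w))" .
  moreover have "t > 0" using pos nn by (simp add: t_def c_def)
  moreover have "t * c \<le> w \<bullet> w"
    using pos nn by (simp add: t_def c_def field_simps)
  ultimately show False using pos by (simp add: zero_le_mult_iff)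
qed

lemma matrix_inv_mult_vec:
  fixes M :: "real ^ 'n ^ 'n"
  assumes "invertible M"
  shows "M *v (matrix_inv M *v x) = x" and "matrix_inv M *v (M *v x) = x"
proof -
  have "M ** matrix_inv M = mat 1 \<and> matrix_inv M ** M = mat 1"
    using assms unfolding invertible_def matrix_inv_def by (rule someI_ex)
  then show "M *v (matrix_inv M *v x) = x" "matrix_inv M *v (M *v x) = x"
    by (simp_all add: matrix_vector_mul_assoc)
qed

lemma pd_invertible:
  assumes "pd M"
  shows "invertible M"
proof -
  have "x = 0" if "M *v x = 0" for x
    using assms that by (metis inner_zero_right less_irrefl pd_def)
  then show ?thesis
    by (meson invertible_left_inverse matrix_left_invertible_ker)
qed

lemma pd_matrix_inv:
  assumes "pd M"
  shows "pd (matrix_inv M)"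
proof -
  note inv = matrix_inv_mult_vec[OF pd_invertible[OF assms]]
  have sym: "symmetric_mat M" using assms by (simp add: pd_def)
  have dot: "(transpose (matrix_inv M) *v x) \<bullet> y = (matrix_inv M *v x) \<bullet> y" for x y
  proof -
    have "(transpose (matrix_inv M) *v x) \<bullet> y = (M *v (matrix_inv M *v x)) \<bullet> (matrix_inv M *v y)"
      by (simp add: inner_transpose_mult inv)
    also have "\<dots> = (matrix_inv M *v x) \<bullet> y"
      by (metis inner_mult_swap[OF sym] inv(1))
    finally show ?thesis .
  qed
  have "transpose (matrix_inv M) *v x = matrix_inv M *v x" for x
    by (rule iffD1[OF vector_eq_rdot]) (intro allI dot)
  then have "symmetric_mat (matrix_inv M)"
    by (simp add: symmetric_mat_def matrix_eq)
  moreover have "0 < x \<bullet> (matrix_inv M *v x)" if "x \<noteq> 0" for x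
  proof -
    have "matrix_inv M *v x \<noteq> 0" using inv(1)[of x] that by force
    then have "0 < (matrix_inv M *v x) \<bullet> (M *v (matrix_inv M *v x))"
      using assms by (simp add: pd_def)
    then show ?thesis by (simp add: inv inner_commute)
  qed
  ultimately show ?thesis by (simp add: pd_def)
qed

lemma matrix_inv_matrix_inv:
  assumes "pd M"
  shows "matrix_inv (matrix_inv M) = M"
proof -
  have "matrix_inv (matrix_inv M) *v x = M *v x" for x
    using matrix_inv_mult_vec(2)[OF pd_invertible[OF assms], of x]
      matrix_inv_mult_vec(2)[OF pd_invertible[OF pd_matrix_inv[OF assms]], of "M *v x"] by simp
  then show ?thesis by (simp add: matrix_eq)
qed

text \<open>
  The difference of the two sides is the form of \<open>M\<close> at \<open>M\<^sup>-\<^sup>1 y - z\<close>. With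
  \<open>inverse_form_attained\<close> this expresses the form of the inverse as a maximum of functions that depend
  on \<open>M\<close> only through its own form.
\<close>

lemma inverse_form_ge:
  assumes "pd M"
  shows "2 * (y \<bullet> z) - z \<bullet> (M *v z) \<le> y \<bullet> (matrix_inv M *v y)"
proof -
  note inv = matrix_inv_mult_vec[OF pd_invertible[OF assms]]
  have sym: "symmetric_mat M" using assms by (simp add: pd_def)
  let ?w = "matrix_inv M *v y"
  have "0 \<le> (?w - z) \<bullet> (M *v (?w - z))" by (rule pd_nonneg[OF assms])
  also have "\<dots> = y \<bullet> ?w - 2 * (y \<bullet> z) + z \<bullet> (M *v z)"
    using inner_mult_swap[OF sym, of ?w z]
    by (simp add: matrix_vector_mult_diff_distrib inner_diff_left inner_diff_right inv inner_commute)
  finally show ?thesis by simp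
qed

lemma inverse_form_attained:
  assumes "pd M"
  shows "\<exists>z. y \<bullet> (matrix_inv M *v y) = 2 * (y \<bullet> z) - z \<bullet> (M *v z)"
  using matrix_inv_mult_vec[OF pd_invertible[OF assms]]
  by (intro exI[of _ "matrix_inv M *v y"]) (simp add: inner_commute)

text \<open>
  Inversion reverses the Loewner order: in the variational formula a larger form is subtracted.
\<close>

lemma inverse_form_antimono:
  assumes "pd M" and "pd N" and "\<And>z. z \<bullet> (M *v z) \<le> z \<bullet> (N *v z)"
  shows "y \<bullet> (matrix_inv N *v y) \<le> y \<bullet> (matrix_inv M *v y)"
proof -
  obtain z where "y \<bullet> (matrix_inv N *v y) = 2 * (y \<bullet> z) - z \<bullet> (N *v z)"
    using inverse_form_attained[OF assms(2)] by blast
  also have "\<dots> \<le> 2 * (y \<bullet> z) - z \<bullet> (M *v z)" using assms(3)[of z] by simp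
  also have "\<dots> \<le> y \<bullet> (matrix_inv M *v y)" by (rule inverse_form_ge[OF assms(1)])
  finally show ?thesis .
qed

section \<open>Eigenvalues\<close>

text \<open>
  By induction on the set of eigenvalues: applying \<open>M - m\<close> to a linear relation removes the eigenvector
  for \<open>m\<close> and multiplies the other coefficients by nonzero numbers.
\<close>

lemma eigenvectors_independent:
  fixes M :: "'a::field ^ 'n ^ 'n"
  assumes "finite L" and "\<And>l. l \<in> L \<Longrightarrow> v l \<noteq> 0 \<and> M *v v l = l *s v l"
    and "(\<Sum>l\<in>L. c l *s v l) = 0" and "l \<in> L"
  shows "c l = 0"
  using assms
proof (induction L arbitrary: c l rule: finite_induct)
  case (insert m L)
  have sum0: "c m *s v m + (\<Sum>l\<in>L. c l *s v l) = 0" using insert by simp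
  have "M *v (c m *s v m + (\<Sum>l\<in>L. c l *s v l)) = 0" by (simp add: sum0)
  also have "M *v (c m *s v m + (\<Sum>l\<in>L. c l *s v l)) = (c m * m) *s v m + (\<Sum>l\<in>L. (c l * l) *s v l)"
    using insert.prems(1)
    by (simp add: vec.add vec.sum vec.scale vec.scale_scale)
  finally have "(c m * m) *s v m + (\<Sum>l\<in>L. (c l * l) *s v l) - m *s (c m *s v m + (\<Sum>l\<in>L. c l *s v l)) = 0"
    using sum0 by simp
  then have "(\<Sum>l\<in>L. (c l * (l - m)) *s v l) = 0"
    by (simp add: vec.scale_right_distrib vec.scale_sum_right vec.scale_scale sum_subtractf[symmetric]
        vec.scale_left_diff_distrib algebra_simps)
  from insert.IH[OF _ this] insert.prems(1) insert.hyps(2) have L0: "c l = 0" if "l \<in> L" for l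
    using that by fastforce
  then have "c m *s v m = 0" using sum0 by simp
  then have "c m = 0" using insert.prems(1)[of m] by simp
  then show ?case using L0 insert.prems(3) by auto
qed simp

text \<open>
  Finiteness is what makes the maxima in the definitions of the largest eigenvalue and of the spectral
  radius meaningful.
\<close>

lemma finite_eigenvalues:
  fixes M :: "'a::field ^ 'n ^ 'n"
  shows "finite (eigenvalues M)"
proof -
  have "\<forall>l\<in>eigenvalues M. \<exists>v. v \<noteq> 0 \<and> M *v v = l *s v" by (auto simp: eigenvalues_def)
  then obtain v where v: "\<And>l. l \<in> eigenvalues M \<Longrightarrow> v l \<noteq> 0 \<and> M *v v l = l *s v l"
    by (auto dest!: bchoice)
  have "card L \<le> CARD('n)" if L: "L \<subseteq> eigenvalues M" "finite L" for L
  proof -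
    have inj: "inj_on v L"
    proof (rule inj_onI)
      fix l m assume lm: "l \<in> L" "m \<in> L" "v l = v m"
      then have "l *s v m = m *s v m" "v m \<noteq> 0" using v L by (metis subsetD)+
      then show "l = m" by (simp add: vec.scale_right_imp_eq)
    qed
    have "vec.independent (v ` L)"
    proof (rule vec.independent_if_scalars_zero)
      fix f x assume s: "(\<Sum>x\<in>v ` L. f x *s x) = 0" and x: "x \<in> v ` L"
      then obtain l where l: "l \<in> L" "x = v l" by blast
      have "(\<Sum>l\<in>L. f (v l) *s v l) = 0" using s by (simp add: sum.reindex[OF inj])
      from eigenvectors_independent[OF L(2) _ this l(1)] v L(1) show "f x = 0" using l(2) by blast
    qed (use L in simp)
    then have "card (v ` L) \<le> vec.dim (v ` L)" using vec.independent_bound_general by blast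
    then show ?thesis
      using dim_subset_UNIV_cart_gen[of "v ` L"] card_image[OF inj] by simp
  qed
  then show ?thesis using finite_if_finite_subsets_card_bdd by blast
qed

text \<open>
  The Rayleigh quotient attains its maximum \<open>\<mu>\<close> on the unit sphere, at \<open>u\<close> say. Then \<open>\<mu> I - M\<close> is
  positive semidefinite with a zero at \<open>u\<close>, so \<open>u\<close> lies in its kernel and \<open>\<mu>\<close> is an eigenvalue.
\<close>

lemma form_le_lambda_max:
  fixes M :: "real ^ 'n ^ 'n"
  assumes sym: "symmetric_mat M"
  shows "x \<bullet> (M *v x) \<le> lambda_max M * (x \<bullet> x)" and "lambda_max M \<in> eigenvalues M"
proof -
  let ?S = "sphere (0 :: real ^ 'n) 1"
  have "continuous_on ?S (\<lambda>x. x \<bullet> (M *v x))"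
    by (intro continuous_intros matrix_vector_mult_linear_continuous_on)
  moreover have "?S \<noteq> {}" by simp
  ultimately obtain u where u: "u \<in> ?S" and umax: "\<And>x. x \<in> ?S \<Longrightarrow> x \<bullet> (M *v x) \<le> u \<bullet> (M *v u)"
    using continuous_attains_sup[of ?S "\<lambda>x. x \<bullet> (M *v x)"] by (metis compact_sphere)
  define \<mu> where "\<mu> = u \<bullet> (M *v u)"
  have le: "x \<bullet> (M *v x) \<le> \<mu> * (x \<bullet> x)" for x
  proof (cases "x = 0")
    case False
    define y where "y = (1 / norm x) *\<^sub>R x"
    have "y \<in> ?S" using False by (simp add: y_def)
    then have "y \<bullet> (M *v y) \<le> \<mu>" using umax by (simp add: \<mu>_def)
    moreover have "y \<bullet> (M *v y) = x \<bullet> (M *v x) / (x \<bullet> x)"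
      by (simp add: y_def matrix_vector_mult_scaleR flip: power2_norm_eq_inner power2_eq_square)
    moreover have "x \<bullet> x > 0" using False by simp
    ultimately show ?thesis by (simp add: field_simps)
  qed simp
  have uu: "u \<bullet> u = 1" using u by (simp add: dot_square_norm)
  (* The maximality of mu says that N is positive semidefinite. *)
  define N where "N = \<mu> *\<^sub>R mat 1 - M"
  have N: "N *v x = \<mu> *\<^sub>R x - M *v x" for x
    by (simp add: N_def matrix_vector_mult_diff_rdistrib scaleR_mult_vec)
  have "symmetric_mat N"
    using sym by (simp add: N_def symmetric_mat_diff symmetric_mat_scaleR symmetric_mat_def transpose_mat
        transpose_minus transpose_scalar)
  then have "psd N" using le by (simp add: psd_def N inner_diff_right)
  moreover have "u \<bullet> (N *v u) = 0" using uu by (simp add: N inner_diff_right \<mu>_def)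
  ultimately have "N *v u = 0" by (rule psd_form_eq_0_imp)
  then have "M *v u = \<mu> *s u" by (simp add: N scalar_mult_eq_scaleR)
  moreover have "u \<noteq> 0" using uu by auto
  ultimately have mem: "\<mu> \<in> eigenvalues M" by (auto simp: eigenvalues_def)
  then have "\<mu> \<le> lambda_max M" unfolding lambda_max_def by (rule Max_ge[OF finite_eigenvalues])
  then have "\<mu> * (x \<bullet> x) \<le> lambda_max M * (x \<bullet> x)" by (rule mult_right_mono) simp
  with le[of x] show "x \<bullet> (M *v x) \<le> lambda_max M * (x \<bullet> x)" by linarith
  show "lambda_max M \<in> eigenvalues M"
    unfolding lambda_max_def using mem by (intro Max_in finite_eigenvalues) auto
qed

lemma lambda_max_pos:
  assumes "pd M"
  shows "0 < lambda_max M"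
proof -
  from form_le_lambda_max(2)[of M] assms obtain v where "v \<noteq> 0" "M *v v = lambda_max M *s v"
    by (auto simp: pd_def eigenvalues_def)
  moreover have "0 < v \<bullet> (M *v v)" using assms \<open>v \<noteq> 0\<close> unfolding pd_def by blast
  ultimately have "0 < lambda_max M * (v \<bullet> v)" by (simp add: scalar_mult_eq_scaleR)
  then show ?thesis by (rule zero_less_mult_pos2) (use \<open>v \<noteq> 0\<close> in simp)
qed

section \<open>Powers of a matrix inside its spectral radius\<close>

text \<open>
  The solution \<open>x(z)\<close> of \<open>(I - z N) x(z) = v\<close> is given by Cramer's rule as a quotient of polynomials in
  \<open>z\<close>, hence is holomorphic for \<open>|z| < R\<close>. Comparing coefficients in \<open>x(z) = v + z N x(z)\<close> identifies its
  Taylor coefficients as \<open>N\<^sup>k v\<close>. The Taylor series converges in the whole disc, so its terms at \<open>\<rho>\<close>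
  tend to zero.
\<close>

lemma resolvent_powers_tendsto_0:
  fixes N :: "complex ^ 'n ^ 'n"
  assumes R: "\<And>z. cmod z < R \<Longrightarrow> det (\<chi> i j. (if i = j then 1 else 0) - z * N $ i $ j) \<noteq> 0"
    and \<rho>: "cmod \<rho> < R"
  shows "(\<lambda>k. (((*v) N ^^ k) v) $ i * \<rho> ^ k) \<longlonglongrightarrow> 0"
proof -
  define W where "W z = (\<chi> i j. (if i = j then 1 else 0) - z * N $ i $ j)" for z
  define x where "x i z = det (\<chi> k j. if j = i then v $ k else W z $ k $ j) / det (W z)" for i z
  define c where "c i = fps_expansion (x i) 0" for i
  have R0: "0 < R" using \<rho> norm_ge_zero[of \<rho>] by linarith
  have holo: "x i holomorphic_on ball 0 R" for i
  proof -
    have "(\<lambda>z. W z $ k $ j) holomorphic_on ball 0 R" for k j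
      by (cases "k = j") (auto simp: W_def intro!: holomorphic_intros)
    moreover from this have "(\<lambda>z. if j = i then v $ k else W z $ k $ j) holomorphic_on ball 0 R" for k j
      by (cases "j = i") auto
    moreover have "det (W z) \<noteq> 0" if "z \<in> ball 0 R" for z using R[of z] that by (simp add: W_def)
    ultimately show ?thesis
      unfolding x_def det_def by (simp, intro holomorphic_intros) auto
  qed
  have sol: "x i z = v $ i + z * (\<Sum>j\<in>UNIV. N $ i $ j * x j z)" if "z \<in> ball 0 R" for i z
  proof -
    have "det (W z) \<noteq> 0" using R[of z] that by (simp add: W_def)
    then have "W z *v (\<chi> i. x i z) = v" using cramer[of "W z" "\<chi> i. x i z" v] by (simp add: x_def)
    then have "(W z *v (\<chi> i. x i z)) $ i = v $ i" by simp
    moreover have "(W z *v (\<chi> i. x i z)) $ i = x i z - z * (\<Sum>j\<in>UNIV. N $ i $ j * x j z)"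
    proof -
      have "(W z *v (\<chi> i. x i z)) $ i = (\<Sum>j\<in>UNIV. (if i = j then x j z else 0) - z * (N $ i $ j * x j z))"
        by (auto simp: matrix_vector_mult_def W_def algebra_simps intro!: sum.cong)
      then show ?thesis by (simp add: sum_subtractf sum_distrib_left)
    qed
    ultimately show ?thesis by (simp add: algebra_simps)
  qed
  have exp: "x i has_fps_expansion c i" for i
    unfolding c_def by (rule has_fps_expansion_fps_expansion[OF open_ball _ holo]) (use R0 in simp)
  (* The equation for x(z) holds near 0, so it holds between the power series. *)
  have c_eq: "c i = fps_const (v $ i) + fps_X * (\<Sum>j\<in>UNIV. fps_const (N $ i $ j) * c j)" for i
  proof (rule fps_expansion_unique_complex[OF exp])
    have "(\<lambda>z. v $ i + z * (\<Sum>j\<in>UNIV. N $ i $ j * x j z)) has_fps_expansion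
      fps_const (v $ i) + fps_X * (\<Sum>j\<in>UNIV. fps_const (N $ i $ j) * c j)"
      by (intro fps_expansion_intros exp)
    moreover have "eventually (\<lambda>z. x i z = v $ i + z * (\<Sum>j\<in>UNIV. N $ i $ j * x j z)) (nhds 0)"
      by (rule eventually_mono[OF eventually_nhds_in_open[OF open_ball, of 0 0 R]]) (use R0 in simp, rule sol)
    ultimately show "x i has_fps_expansion fps_const (v $ i) + fps_X * (\<Sum>j\<in>UNIV. fps_const (N $ i $ j) * c j)"
      by (subst has_fps_expansion_cong[OF _ refl])
  qed
  have coeff: "fps_nth (c i) k = (((*v) N ^^ k) v) $ i" for i k
  proof (induction k arbitrary: i)
    case 0
    show ?case by (subst c_eq) simp
  next
    case (Suc k)
    show ?case
      by (subst c_eq) (simp add: fps_sum_nth Suc.IH matrix_vector_mult_def[of N "((*v) N ^^ k) v"])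
  qed
  have "ereal R \<le> fps_conv_radius (c i)"
    unfolding c_def by (rule conv_radius_fps_expansion) (use holo in simp)
  then have "summable (\<lambda>k. fps_nth (c i) k * \<rho> ^ k)"
    using \<rho> by (intro summable_fps) (metis ereal_less(3) less_ereal.simps(1) order_less_le_trans)
  then show ?thesis using summable_LIMSEQ_zero coeff by simp
qed

text \<open>
  If \<open>I - z F\<close> is singular, then \<open>1 / z\<close> is an eigenvalue of \<open>F\<close>. So the resolvent is holomorphic in
  the disc of radius \<open>1 / r\<close> for the spectral radius \<open>r\<close>, or everywhere if \<open>r = 0\<close>. The transpose appears
  because quadratic forms are pulled back along \<open>F\<^sup>T\<close>.
\<close>

lemma scaled_powers_tendsto_0:
  fixes F :: "real ^ 'n ^ 'n"
  assumes "0 < \<rho>" and r: "spectral_radius F \<noteq> 0 \<longrightarrow> \<rho> < 1 / spectral_radius F"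
  shows "(\<lambda>k. ((\<lambda>x. \<rho> *\<^sub>R (transpose F *v x)) ^^ k) x) \<longlonglongrightarrow> 0"
proof -
  (* For r = 0 any radius beyond rho will do. *)
  define R where "R = (if spectral_radius F = 0 then \<rho> + 1 else 1 / spectral_radius F)"
  define Fc where "Fc = map_matrix complex_of_real F"
  define N where "N = transpose Fc"
  have "det (\<chi> i j. (if i = j then 1 else 0) - z * N $ i $ j) \<noteq> 0" if z: "cmod z < R" for z
  proof
    define W where "W = (\<chi> i j. (if i = j then 1 else 0) - z * Fc $ i $ j)"
    have W: "W *v w = w - z *s (Fc *v w)" for w
    proof -
      have "(W *v w) $ i = (\<Sum>j\<in>UNIV. (if i = j then w $ j else 0) - z * (Fc $ i $ j * w $ j))" for i
        by (auto simp: matrix_vector_mult_def W_def algebra_simps intro!: sum.cong)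
      then show ?thesis
        by (simp add: vec_eq_iff sum_subtractf sum_distrib_left matrix_vector_mult_def)
    qed
    assume "det (\<chi> i j. (if i = j then 1 else 0) - z * N $ i $ j) = 0"
    also have "(\<chi> i j. (if i = j then 1 else 0) - z * N $ i $ j) = transpose W"
      by (auto simp: W_def N_def transpose_def vec_eq_iff)
    finally have "\<not> invertible W" by (simp add: det_transpose invertible_det_nz)
    then obtain w where w: "w \<noteq> 0" "W *v w = 0"
      by (meson invertible_left_inverse matrix_left_invertible_ker)
    then have eq: "w = z *s (Fc *v w)" by (simp add: W)
    have "z \<noteq> 0" using eq w(1) by auto
    then have "Fc *v w = (1 / z) *s w" using eq by (metis divide_self mult.commute times_divide_eq_right mult.right_neutral vec.scale_one vec.scale_scale)
    with w(1) have "1 / z \<in> complex_eigenvalues F"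
      by (auto simp: complex_eigenvalues_def eigenvalues_def Fc_def)
    then have "cmod (1 / z) \<le> spectral_radius F"
      unfolding spectral_radius_def complex_eigenvalues_def by (intro Max_ge finite_imageI finite_eigenvalues imageI)
    moreover have "0 < cmod (1 / z)" using \<open>z \<noteq> 0\<close> by simp
    ultimately have r0: "0 < spectral_radius F" by linarith
    have "1 \<le> spectral_radius F * cmod z"
      using \<open>cmod (1 / z) \<le> spectral_radius F\<close> \<open>z \<noteq> 0\<close> by (simp add: norm_divide field_simps)
    then show False using z r0 by (auto simp: R_def field_simps)
  qed
  moreover have "cmod (of_real \<rho>) < R" using assms by (simp add: R_def)
  ultimately have lim: "(\<lambda>k. (((*v) N ^^ k) v) $ i * of_real \<rho> ^ k) \<longlonglongrightarrow> 0" for v i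
    by (rule resolvent_powers_tendsto_0)
  have pow: "complex_of_real (((\<lambda>x. \<rho> *\<^sub>R (transpose F *v x)) ^^ k) x $ i)
      = (((*v) N ^^ k) (\<chi> i. of_real (x $ i))) $ i * of_real \<rho> ^ k" for k i
  proof (induction k arbitrary: i)
    case (Suc k)
    let ?y = "((\<lambda>x. \<rho> *\<^sub>R (transpose F *v x)) ^^ k) x"
    have "complex_of_real (((\<lambda>x. \<rho> *\<^sub>R (transpose F *v x)) ^^ Suc k) x $ i)
      = of_real \<rho> * (\<Sum>j\<in>UNIV. N $ i $ j * of_real (?y $ j))"
      by (simp add: matrix_vector_mult_def N_def Fc_def transpose_def)
    then show ?case
      by (simp add: Suc.IH matrix_vector_mult_def[of N] sum_distrib_left sum_distrib_right mult_ac)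
  qed simp
  have "(\<lambda>k. ((\<lambda>x. \<rho> *\<^sub>R (transpose F *v x)) ^^ k) x $ i) \<longlonglongrightarrow> 0" for i
  proof -
    have "(\<lambda>k. complex_of_real (((\<lambda>x. \<rho> *\<^sub>R (transpose F *v x)) ^^ k) x $ i)) \<longlonglongrightarrow> of_real 0"
      unfolding pow using lim by simp
    then show ?thesis by (simp only: tendsto_of_real_iff)
  qed
  then show ?thesis by (intro vec_tendstoI) simp
qed

section \<open>The Lyapunov equation\<close>

lemma bilinear_tendsto_0:
  fixes S :: "real ^ 'n ^ 'n"
  assumes "X \<longlonglongrightarrow> 0" "Y \<longlonglongrightarrow> 0"
  shows "(\<lambda>k. X k \<bullet> (S *v Y k)) \<longlonglongrightarrow> 0"
proof -
  have "(\<lambda>k. S *v Y k) \<longlonglongrightarrow> S *v 0"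
    by (rule bounded_linear.tendsto[OF matrix_vector_mul_bounded_linear assms(2)])
  from tendsto_inner[OF assms(1) this] show ?thesis by simp
qed

text \<open>
  Iterating the equation gives \<open>x\<^sup>T S y = ((\<rho> F\<^sup>T)\<^sup>k x)\<^sup>T S ((\<rho> F\<^sup>T)\<^sup>k y)\<close> for all \<open>k\<close>.
\<close>

lemma lyapunov_homogeneous_trivial:
  fixes S :: "real ^ 'n ^ 'n"
  assumes lim: "\<And>x. (\<lambda>k. ((\<lambda>x. \<rho> *\<^sub>R (transpose F *v x)) ^^ k) x) \<longlonglongrightarrow> 0"
    and S: "S = \<rho>\<^sup>2 *\<^sub>R (F ** S ** transpose F)"
  shows "S = 0"
proof -
  define T where "T x = \<rho> *\<^sub>R (transpose F *v x)" for x
  have step: "x \<bullet> (S *v y) = T x \<bullet> (S *v T y)" for x y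
  proof -
    have "x \<bullet> (S *v y) = x \<bullet> ((\<rho>\<^sup>2 *\<^sub>R (F ** S ** transpose F)) *v y)" using S by simp
    then show ?thesis
      by (simp add: scaleR_mult_vec inner_congruence T_def matrix_vector_mult_scaleR power2_eq_square)
  qed
  have iter: "x \<bullet> (S *v y) = (T ^^ k) x \<bullet> (S *v (T ^^ k) y)" for x y k
    by (induction k) (use step in auto)
  have "x \<bullet> (S *v y) = 0" for x y
    using bilinear_tendsto_0[OF lim[of x] lim[of y], of S] iter[of x y]
    unfolding T_def by (simp add: LIMSEQ_const_iff)
  then have "S *v y = 0" for y by (metis inner_eq_zero_iff)
  then show ?thesis by (simp add: matrix_eq)
qed

text \<open>
  The map \<open>S \<mapsto> S - \<rho>\<^sup>2 F S F\<^sup>T\<close> is an injective linear endomorphism of a finite-dimensional space, hence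
  bijective.
\<close>

lemma lyapunov_equation_ex1:
  fixes F Q :: "real ^ 'n ^ 'n"
  assumes lim: "\<And>x. (\<lambda>k. ((\<lambda>x. \<rho> *\<^sub>R (transpose F *v x)) ^^ k) x) \<longlonglongrightarrow> 0"
  shows "\<exists>!S. S = \<rho>\<^sup>2 *\<^sub>R (F ** S ** transpose F) + Q"
proof -
  define L where "L S = S - \<rho>\<^sup>2 *\<^sub>R (F ** S ** transpose F)" for S :: "real ^ 'n ^ 'n"
  have L: "L S *v x = S *v x - \<rho>\<^sup>2 *\<^sub>R (F *v (S *v (transpose F *v x)))" for S x
    by (simp add: L_def matrix_vector_mult_diff_rdistrib scaleR_mult_vec flip: matrix_vector_mul_assoc)
  have lin: "linear L"
    by (rule linearI) (simp_all add: matrix_eq L matrix_vector_mult_add_rdistrib scaleR_mult_vec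
        matrix_vector_right_distrib matrix_vector_mult_scaleR scaleR_add_right scaleR_diff_right)
  have "inj L"
    unfolding linear_injective_0[OF lin]
    using lyapunov_homogeneous_trivial[OF lim] by (auto simp: L_def)
  moreover from this have "surj L" by (simp add: linear_injective_imp_surjective[OF lin])
  ultimately have "\<exists>!S. L S = Q" by (metis injD surjD)
  moreover have "L S = Q \<longleftrightarrow> S = \<rho>\<^sup>2 *\<^sub>R (F ** S ** transpose F) + Q" for S
    by (auto simp: L_def algebra_simps)
  ultimately show ?thesis by simp
qed

text \<open>
  The dual form of reachability: an \<open>A\<^sup>T\<close>-invariant set that
  is annihilated by \<open>B\<^sup>T\<close> contains at most the zero vector, since each of its elements is orthogonal to
  all columns of the reachability matrix.
\<close>

lemma reachable_imp_separating:
  fixes A :: "real ^ 'n ^ 'n" and B :: "real ^ 'm ^ 'n"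
  assumes "reachable A B"
    and Z: "\<And>x. x \<in> Z \<Longrightarrow> transpose B *v x = 0 \<and> transpose A *v x \<in> Z"
    and "x \<in> Z"
  shows "x = 0"
proof -
  have "transpose B *v (transpose (mat_power A k) *v x) = 0" if "x \<in> Z" for k x
    using that
  proof (induction k arbitrary: x)
    case 0
    then show ?case using Z by (simp add: mat_power_def transpose_mat)
  next
    case (Suc k)
    have "mat_power A (Suc k) = A ** mat_power A k" by (simp add: mat_power_def)
    then have "transpose (mat_power A (Suc k)) *v x = transpose (mat_power A k) *v (transpose A *v x)"
      by (simp add: matrix_transpose_mul matrix_vector_mul_assoc)
    then show ?case using Suc.IH[of "transpose A *v x"] Z Suc.prems by metis
  qed
  then have zero: "transpose (mat_power A k ** B) *v x = 0" for k
    using \<open>x \<in> Z\<close> by (simp add: matrix_transpose_mul matrix_vector_mul_assoc)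
  let ?U = "\<Union>k \<in> {..<CARD('n)}. columns (mat_power A k ** B)"
  have "x \<bullet> c = 0" if "c \<in> ?U" for c
  proof -
    from that obtain k j where "c = column j (mat_power A k ** B)"
      by (auto simp: columns_def)
    then have "x \<bullet> c = (transpose (mat_power A k ** B) *v x) $ j"
      by (simp add: matrix_vector_mul_component transpose_def column_def inner_commute)
    then show ?thesis by (simp add: zero)
  qed
  moreover have "span ?U = UNIV"
    using assms(1) by (simp add: reachable_def flip: dim_eq_full)
  moreover from this have "x \<in> span ?U" by simp
  ultimately have "orthogonal x x" by (intro orthogonal_to_span[of x ?U]) (auto simp: orthogonal_def)
  then show ?thesis by (simp add: orthogonal_def)
qed

text \<open>
  Symmetry follows from uniqueness, as the transpose solves the same equation. The form of \<open>S\<close> does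
  not increase along \<open>x \<mapsto> \<rho> F\<^sup>T x\<close> and tends to zero there, so it is nonnegative. On its zero set the
  vectors \<open>B\<^sup>T x\<close> and \<open>G\<^sup>T x\<close> vanish, so that \<open>F\<^sup>T x = A\<^sup>T x\<close>, and the zero set is \<open>A\<^sup>T\<close>-invariant;
  reachability then leaves only \<open>x = 0\<close>.
\<close>

lemma Sigma_rho_properties:
  fixes A :: "real ^ 'n ^ 'n" and B :: "real ^ 'm ^ 'n" and C :: "real ^ 'n ^ 'p" and G :: "real ^ 'p ^ 'n"
  assumes "reachable A B" and "0 < \<rho>"
    and "spectral_radius (A - G ** C) \<noteq> 0 \<longrightarrow> \<rho> < 1 / spectral_radius (A - G ** C)"
  defines "F \<equiv> A - G ** C"
  defines "S \<equiv> Sigma_rho A B C G \<rho>"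
  shows Sigma_rho_equation: "S = \<rho>\<^sup>2 *\<^sub>R (F ** S ** transpose F) + B ** transpose B + G ** transpose G" (is ?eq)
    and pd_Sigma_rho: "pd S"
proof -
  have lim: "(\<lambda>k. ((\<lambda>x. \<rho> *\<^sub>R (transpose F *v x)) ^^ k) x) \<longlonglongrightarrow> 0" for x
    using assms by (intro scaled_powers_tendsto_0) auto
  note ex1 = lyapunov_equation_ex1[OF lim, of "B ** transpose B + G ** transpose G", unfolded add.assoc[symmetric]]
  from theI'[OF ex1] show eq: ?eq by (simp add: S_def Sigma_rho_def F_def)
  have "transpose S = \<rho>\<^sup>2 *\<^sub>R (F ** transpose S ** transpose F) + B ** transpose B + G ** transpose G"
    by (subst eq) (simp add: transpose_plus transpose_scalar matrix_transpose_mul matrix_mul_assoc)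
  with ex1 eq have sym: "symmetric_mat S" unfolding symmetric_mat_def by blast
  define T where "T x = \<rho> *\<^sub>R (transpose F *v x)" for x
  have form: "x \<bullet> (S *v x) = T x \<bullet> (S *v T x) + (transpose B *v x) \<bullet> (transpose B *v x)
      + (transpose G *v x) \<bullet> (transpose G *v x)" for x
  proof -
    have "x \<bullet> (S *v x) = x \<bullet> ((\<rho>\<^sup>2 *\<^sub>R (F ** S ** transpose F) + B ** transpose B + G ** transpose G) *v x)"
      using eq by simp
    then show ?thesis
      by (simp add: matrix_vector_mult_add_rdistrib inner_add_right scaleR_mult_vec inner_congruence
          form_cogram T_def matrix_vector_mult_scaleR power2_eq_square)
  qed
  have nonneg: "0 \<le> x \<bullet> (S *v x)" for x
  proof -
    have "(T ^^ k) x \<bullet> (S *v (T ^^ k) x) \<le> x \<bullet> (S *v x)" for k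
    proof (induction k)
      case (Suc k)
      have "(T ^^ Suc k) x \<bullet> (S *v (T ^^ Suc k) x) \<le> (T ^^ k) x \<bullet> (S *v (T ^^ k) x)"
        using form[of "(T ^^ k) x"] by (simp add: add_increasing2)
      with Suc show ?case by linarith
    qed simp
    moreover have "(\<lambda>k. (T ^^ k) x \<bullet> (S *v (T ^^ k) x)) \<longlonglongrightarrow> 0"
      unfolding T_def by (rule bilinear_tendsto_0[OF lim lim])
    ultimately show ?thesis by (intro LIMSEQ_le_const2) auto
  qed
  define Z where "Z = {x. x \<bullet> (S *v x) = 0}"
  have Z: "transpose B *v x = 0 \<and> transpose A *v x \<in> Z" if "x \<in> Z" for x
  proof -
    have "T x \<bullet> (S *v T x) = 0 \<and> (transpose B *v x) \<bullet> (transpose B *v x) = 0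
        \<and> (transpose G *v x) \<bullet> (transpose G *v x) = 0"
      using form[of x] nonneg[of "T x"] that inner_ge_zero[of "transpose B *v x"]
        inner_ge_zero[of "transpose G *v x"] unfolding Z_def mem_Collect_eq by linarith
    then have *: "T x \<bullet> (S *v T x) = 0" "transpose B *v x = 0" "transpose G *v x = 0" by auto
    have "transpose F *v x = transpose A *v x - transpose C *v (transpose G *v x)"
      by (simp add: F_def transpose_minus matrix_transpose_mul matrix_vector_mult_diff_rdistrib
          matrix_vector_mul_assoc)
    then have "T x = \<rho> *\<^sub>R (transpose A *v x)" using * by (simp add: T_def)
    with * \<open>0 < \<rho>\<close> show ?thesis by (simp add: Z_def matrix_vector_mult_scaleR)
  qed
  have nz: "x = 0" if "x \<in> Z" for x
    by (rule reachable_imp_separating[OF assms(1), where Z = Z]) (use Z that in simp_all)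
  show "pd S"
    unfolding pd_def
  proof (intro conjI allI impI sym)
    fix x :: "real ^ 'n" assume "x \<noteq> 0"
    then have "x \<bullet> (S *v x) \<noteq> 0" using nz[of x] by (auto simp: Z_def)
    with nonneg[of x] show "0 < x \<bullet> (S *v x)" by simp
  qed
qed

section \<open>The risk-sensitive Riccati step\<close>

text \<open>
  That \<open>D\<^sup>T D \<le> \<lambda> S\<^sup>-\<^sup>1\<close> for the largest eigenvalue \<open>\<lambda>\<close> of \<open>D S D\<^sup>T\<close> is usually read off from
  \<open>S\<^sup>1\<^sup>/\<^sup>2 D\<^sup>T D S\<^sup>1\<^sup>/\<^sup>2\<close> and \<open>D S D\<^sup>T\<close> having the same nonzero eigenvalues. Here the variational formula
  for \<open>S\<^sup>-\<^sup>1\<close> is tested at \<open>w = D\<^sup>T D z / \<lambda>\<close>.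
\<close>

lemma gram_le_lambda_max_inverse:
  fixes S :: "real ^ 'n ^ 'n" and D :: "real ^ 'n ^ 'q"
  assumes "pd S" and pos: "0 < lambda_max (D ** S ** transpose D)"
  shows "(D *v z) \<bullet> (D *v z) \<le> lambda_max (D ** S ** transpose D) * (z \<bullet> (matrix_inv S *v z))"
proof -
  define l where "l = lambda_max (D ** S ** transpose D)"
  define u where "u = D *v z"
  define w where "w = (1 / l) *\<^sub>R (transpose D *v u)"
  have wz: "z \<bullet> w = (u \<bullet> u) / l"
    by (subst inner_commute) (simp add: w_def u_def inner_transpose_mult)
  have "w \<bullet> (S *v w) = (u \<bullet> ((D ** S ** transpose D) *v u)) / l\<^sup>2"
    by (simp add: w_def inner_congruence matrix_vector_mult_scaleR power2_eq_square)
  also have "\<dots> \<le> (l * (u \<bullet> u)) / l\<^sup>2"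
    unfolding l_def using assms(1)
    by (intro divide_right_mono form_le_lambda_max(1) symmetric_mat_congruence) (auto simp: pd_def)
  also have "\<dots> = (u \<bullet> u) / l" using pos by (simp add: power2_eq_square l_def)
  finally have "(u \<bullet> u) / l \<le> 2 * (z \<bullet> w) - w \<bullet> (S *v w)" by (simp add: wz)
  also have "\<dots> \<le> z \<bullet> (matrix_inv S *v z)" by (rule inverse_form_ge[OF assms(1)])
  finally show ?thesis using pos by (simp add: field_simps u_def l_def)
qed

text \<open>
  Optimality of the filter gain: for any splitting \<open>A\<^sup>T x = a + C\<^sup>T b\<close>, here later with \<open>a = F\<^sup>T x\<close> and
  \<open>b = G\<^sup>T x\<close>, the variational expression for \<open>W + C\<^sup>T C\<close> separates into one for \<open>W\<close> at \<open>a\<close> and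
  one for the identity at \<open>b\<close>.
\<close>

lemma innovation_form_le:
  fixes W :: "real ^ 'n ^ 'n" and C :: "real ^ 'n ^ 'p"
  assumes "pd W" and "pd (W + transpose C ** C)"
  shows "(a + transpose C *v b) \<bullet> (matrix_inv (W + transpose C ** C) *v (a + transpose C *v b))
    \<le> a \<bullet> (matrix_inv W *v a) + b \<bullet> b"
proof -
  let ?y = "a + transpose C *v b"
  obtain z where "?y \<bullet> (matrix_inv (W + transpose C ** C) *v ?y)
      = 2 * (?y \<bullet> z) - z \<bullet> ((W + transpose C ** C) *v z)"
    using inverse_form_attained[OF assms(2)] by blast
  also have "\<dots> = (2 * (a \<bullet> z) - z \<bullet> (W *v z)) + (2 * (b \<bullet> (C *v z)) - (C *v z) \<bullet> (C *v z))"
    by (simp add: inner_add_left inner_transpose_mult matrix_vector_mult_add_rdistrib inner_add_right form_gram)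
  also have "\<dots> \<le> a \<bullet> (matrix_inv W *v a) + b \<bullet> b"
  proof (rule add_mono)
    show "2 * (a \<bullet> z) - z \<bullet> (W *v z) \<le> a \<bullet> (matrix_inv W *v a)" by (rule inverse_form_ge[OF assms(1)])
    have "0 \<le> (b - C *v z) \<bullet> (b - C *v z)" by simp
    then show "2 * (b \<bullet> (C *v z)) - (C *v z) \<bullet> (C *v z) \<le> b \<bullet> b"
      by (simp add: inner_diff_left inner_diff_right inner_commute)
  qed
  finally show ?thesis .
qed

text \<open>
  The inequality \<open>S\<^sup>-\<^sup>1 \<le> c W\<close> is inverted to \<open>W\<^sup>-\<^sup>1 \<le> c S\<close>. Scaling the maximiser \<open>z\<close> by
  \<open>1 / c\<close> turns its value for \<open>W\<close> into at most \<open>c\<close> times a value for \<open>S\<^sup>-\<^sup>1\<close>.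
\<close>

lemma inverse_form_le_scaled:
  assumes "pd W" and "pd S" and "0 < c"
    and "\<And>z. z \<bullet> (matrix_inv S *v z) \<le> c * (z \<bullet> (W *v z))"
  shows "y \<bullet> (matrix_inv W *v y) \<le> c * (y \<bullet> (S *v y))"
proof -
  obtain z where z: "y \<bullet> (matrix_inv W *v y) = 2 * (y \<bullet> z) - z \<bullet> (W *v z)"
    using inverse_form_attained[OF assms(1)] by blast
  have "2 * (y \<bullet> ((1 / c) *\<^sub>R z)) - ((1 / c) *\<^sub>R z) \<bullet> (matrix_inv S *v ((1 / c) *\<^sub>R z))
      \<le> y \<bullet> (S *v y)"
    using inverse_form_ge[OF pd_matrix_inv[OF assms(2)], of y "(1 / c) *\<^sub>R z"]
    unfolding matrix_inv_matrix_inv[OF assms(2)] .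
  then have "c * (2 * (y \<bullet> ((1 / c) *\<^sub>R z)) - ((1 / c) *\<^sub>R z) \<bullet> (matrix_inv S *v ((1 / c) *\<^sub>R z)))
      \<le> c * (y \<bullet> (S *v y))"
    using \<open>0 < c\<close> by (intro mult_left_mono) auto
  then have "2 * (y \<bullet> z) - (z \<bullet> (matrix_inv S *v z)) / c \<le> c * (y \<bullet> (S *v y))"
    using \<open>0 < c\<close> by (simp add: matrix_vector_mult_scaleR algebra_simps)
  moreover have "(z \<bullet> (matrix_inv S *v z)) / c \<le> z \<bullet> (W *v z)"
    using assms(4)[of z] \<open>0 < c\<close> by (simp add: field_simps)
  ultimately show ?thesis using z by linarith
qed

lemma risk_riccati_form:
  fixes A :: "real ^ 'n ^ 'n"
  shows "x \<bullet> (risk_riccati A B C D \<theta> P *v x)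
    = (transpose A *v x) \<bullet> (matrix_inv (matrix_inv P + transpose C ** C - \<theta> *\<^sub>R (transpose D ** D)) *v (transpose A *v x))
      + (transpose B *v x) \<bullet> (transpose B *v x)"
  by (simp add: risk_riccati_def matrix_vector_mult_add_rdistrib inner_add_right inner_congruence form_cogram)

text \<open>
  Since \<open>A\<close> may be singular, the first summand of the step need not be definite. A zero \<open>x\<close> of the form
  satisfies \<open>A\<^sup>T x = 0\<close> and \<open>B\<^sup>T x = 0\<close>, which reachability excludes for \<open>x \<noteq> 0\<close>.
\<close>

lemma pd_risk_riccati:
  assumes "reachable A B"
    and M: "pd (matrix_inv P + transpose C ** C - \<theta> *\<^sub>R (transpose D ** D))" (is "pd ?M")
  shows "pd (risk_riccati A B C D \<theta> P)"
proof -
  have Minv: "pd (matrix_inv ?M)" by (rule pd_matrix_inv[OF M])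
  have nz: "x \<bullet> (risk_riccati A B C D \<theta> P *v x) \<noteq> 0" if "x \<noteq> 0" for x
  proof
    assume "x \<bullet> (risk_riccati A B C D \<theta> P *v x) = 0"
    then have "(transpose A *v x) \<bullet> (matrix_inv ?M *v (transpose A *v x)) = 0
        \<and> (transpose B *v x) \<bullet> (transpose B *v x) = 0"
      using pd_nonneg[OF Minv, of "transpose A *v x"] inner_ge_zero[of "transpose B *v x"]
      unfolding risk_riccati_form by linarith
    then have "transpose A *v x = 0" "transpose B *v x = 0"
      using Minv by (auto simp: pd_def)
    then have "x = 0" by (intro reachable_imp_separating[OF assms(1), of "{x, 0}"]) auto
    with that show False by simp
  qed
  have nonneg: "0 \<le> x \<bullet> (risk_riccati A B C D \<theta> P *v x)" for x
    unfolding risk_riccati_form using pd_nonneg[OF Minv] by (simp add: add_nonneg_nonneg)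
  have "symmetric_mat (risk_riccati A B C D \<theta> P)"
    unfolding risk_riccati_def using Minv
    by (intro symmetric_mat_add symmetric_mat_congruence symmetric_mat_cogram) (simp add: pd_def)
  moreover have "0 < x \<bullet> (risk_riccati A B C D \<theta> P *v x)" if "x \<noteq> 0" for x
    using nz[OF that] nonneg[of x] by simp
  ultimately show ?thesis by (simp add: pd_def)
qed

text \<open>
  Two inversions, each of which reverses the order.
\<close>

lemma risk_riccati_mono:
  assumes "pd P" "pd P'" "P \<preceq>\<^sub>L P'"
    and M: "pd (matrix_inv P + transpose C ** C - \<theta> *\<^sub>R (transpose D ** D))" 
    and M': "pd (matrix_inv P' + transpose C ** C - \<theta> *\<^sub>R (transpose D ** D))"
  shows "x \<bullet> (risk_riccati A B C D \<theta> P *v x) \<le> x \<bullet> (risk_riccati A B C D \<theta> P' *v x)"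
proof -
  have inv: "z \<bullet> (matrix_inv P' *v z) \<le> z \<bullet> (matrix_inv P *v z)" for z
    by (rule inverse_form_antimono[OF assms(1,2)]) (use assms(3) in \<open>simp add: loewner_le_iff_form\<close>)
  show ?thesis
    unfolding risk_riccati_form
    by (rule add_right_mono, rule inverse_form_antimono[OF M' M])
      (simp add: inv matrix_vector_mult_add_rdistrib matrix_vector_mult_diff_rdistrib inner_add_right inner_diff_right)
qed

text \<open>
  Subtracting \<open>\<theta> D\<^sup>T D \<le> (1 - \<rho>\<^sup>-\<^sup>2) S\<^sup>-\<^sup>1\<close> from \<open>P\<^sup>-\<^sup>1 \<ge> S\<^sup>-\<^sup>1\<close> leaves at least \<open>\<rho>\<^sup>-\<^sup>2 S\<^sup>-\<^sup>1\<close>; adding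
  \<open>C\<^sup>T C\<close> preserves definiteness.
\<close>

lemma riccati_information_bounds:
  fixes S :: "real ^ 'n ^ 'n"
  assumes S: "pd S" and P: "pd P" "P \<preceq>\<^sub>L S" and \<rho>: "0 < \<rho>"
    and \<theta>: "\<And>z. \<theta> * ((D *v z) \<bullet> (D *v z)) \<le> (1 - 1 / \<rho>\<^sup>2) * (z \<bullet> (matrix_inv S *v z))"
  defines "W \<equiv> matrix_inv P - \<theta> *\<^sub>R (transpose D ** D)"
  shows "z \<bullet> (matrix_inv S *v z) \<le> \<rho>\<^sup>2 * (z \<bullet> (W *v z))"
    and "pd W" and "pd (matrix_inv P + transpose C ** C - \<theta> *\<^sub>R (transpose D ** D))"
proof -
  have W: "z \<bullet> (W *v z) = z \<bullet> (matrix_inv P *v z) - \<theta> * ((D *v z) \<bullet> (D *v z))" for z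
    by (simp add: W_def matrix_vector_mult_diff_rdistrib inner_diff_right scaleR_mult_vec form_gram)
  have SP: "z \<bullet> (matrix_inv S *v z) \<le> z \<bullet> (matrix_inv P *v z)" for z
    by (rule inverse_form_antimono[OF P(1) S]) (use P(2) in \<open>simp add: loewner_le_iff_form\<close>)
  have "(1 / \<rho>\<^sup>2) * (z \<bullet> (matrix_inv S *v z)) \<le> z \<bullet> (W *v z)" for z
    using W[of z] SP[of z] \<theta>[of z] by (simp add: algebra_simps)
  then show bound: "z \<bullet> (matrix_inv S *v z) \<le> \<rho>\<^sup>2 * (z \<bullet> (W *v z))" for z
    using \<rho> by (simp add: field_simps)
  have symW: "symmetric_mat W"
    unfolding W_def using pd_matrix_inv[OF P(1)]
    by (intro symmetric_mat_diff symmetric_mat_scaleR symmetric_mat_gram) (simp add: pd_def)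
  have posW: "0 < z \<bullet> (W *v z)" if "z \<noteq> 0" for z
  proof -
    have "0 < z \<bullet> (matrix_inv S *v z)" using pd_matrix_inv[OF S] that by (simp add: pd_def)
    with bound[of z] have "0 < \<rho>\<^sup>2 * (z \<bullet> (W *v z))" by linarith
    then show ?thesis using \<rho> by (simp add: zero_less_mult_iff)
  qed
  show "pd W" using symW posW by (simp add: pd_def)
  have M: "matrix_inv P + transpose C ** C - \<theta> *\<^sub>R (transpose D ** D) = W + transpose C ** C"
    by (simp add: W_def)
  show "pd (matrix_inv P + transpose C ** C - \<theta> *\<^sub>R (transpose D ** D))"
    unfolding M using symW posW
    by (simp add: pd_def symmetric_mat_add symmetric_mat_gram matrix_vector_mult_add_rdistrib
        inner_add_right form_gram add_pos_nonneg)
qed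

text \<open>
  Replacing the optimal gain by \<open>G\<close> and then \<open>W\<^sup>-\<^sup>1\<close> by its bound \<open>\<rho>\<^sup>2 S\<close> produces exactly the right-hand
  side of the Lyapunov equation.
\<close>

lemma risk_riccati_le:
  fixes S :: "real ^ 'n ^ 'n"
  assumes S: "pd S" and P: "pd P" "P \<preceq>\<^sub>L S" and \<rho>: "0 < \<rho>"
    and \<theta>: "\<And>z. \<theta> * ((D *v z) \<bullet> (D *v z)) \<le> (1 - 1 / \<rho>\<^sup>2) * (z \<bullet> (matrix_inv S *v z))"
    and eq: "S = \<rho>\<^sup>2 *\<^sub>R ((A - G ** C) ** S ** transpose (A - G ** C)) + B ** transpose B + G ** transpose G"
  shows "x \<bullet> (risk_riccati A B C D \<theta> P *v x) \<le> x \<bullet> (S *v x)"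
proof -
  define W where "W = matrix_inv P - \<theta> *\<^sub>R (transpose D ** D)"
  note bounds = riccati_information_bounds[OF S P \<rho> \<theta>, folded W_def]
  define F where "F = A - G ** C"
  define a where "a = transpose F *v x"
  define b where "b = transpose G *v x"
  have y: "transpose A *v x = a + transpose C *v b"
    by (simp add: a_def b_def F_def transpose_minus matrix_transpose_mul matrix_vector_mult_diff_rdistrib
        matrix_vector_mul_assoc)
  have M: "matrix_inv P + transpose C ** C - \<theta> *\<^sub>R (transpose D ** D) = W + transpose C ** C"
    by (simp add: W_def)
  have aa: "a \<bullet> (matrix_inv W *v a) \<le> \<rho>\<^sup>2 * (a \<bullet> (S *v a))"
    by (rule inverse_form_le_scaled[OF bounds(2) S _ bounds(1)]) (use \<rho> in simp)
  have "x \<bullet> (risk_riccati A B C D \<theta> P *v x)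
      \<le> a \<bullet> (matrix_inv W *v a) + b \<bullet> b + (transpose B *v x) \<bullet> (transpose B *v x)"
    unfolding risk_riccati_form y M
    by (rule add_right_mono, rule innovation_form_le[OF bounds(2) bounds(3)[of C, unfolded M]])
  also have "\<dots> \<le> \<rho>\<^sup>2 * (a \<bullet> (S *v a)) + b \<bullet> b + (transpose B *v x) \<bullet> (transpose B *v x)"
    by (intro add_right_mono aa)
  also have "\<dots> = x \<bullet> ((\<rho>\<^sup>2 *\<^sub>R (F ** S ** transpose F) + B ** transpose B + G ** transpose G) *v x)"
    by (simp add: matrix_vector_mult_add_rdistrib inner_add_right scaleR_mult_vec inner_congruence
        form_cogram a_def b_def)
  also have "\<dots> = x \<bullet> (S *v x)" using eq by (simp add: F_def)
  finally show ?thesis by simp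
qed

theorem lemma4:
  fixes A :: "real ^ 'n ^ 'n" and B :: "real ^ 'm ^ 'n" and C :: "real ^ 'n ^ 'p"
    and D :: "real ^ 'n ^ 'q" and G :: "real ^ 'p ^ 'n"
    and \<rho> \<theta> :: real and P :: "nat \<Rightarrow> real ^ 'n ^ 'n"
  assumes "CARD('q) \<le> CARD('n)" and "rank D = CARD('q)"
    and "reachable A B" and "observable C A"
    and "stable_mat (A - G ** C)"
    and "1 < \<rho>"
    and "spectral_radius (A - G ** C) \<noteq> 0 \<longrightarrow> \<rho> < 1 / spectral_radius (A - G ** C)"
    and "0 \<le> \<theta>" and "\<theta> \<le> beta_rho A B C D G \<rho>"
    and "\<And>t. P (Suc t) = risk_riccati A B C D \<theta> (P t)"
  shows "(0 \<prec>\<^sub>L P 0 \<and> P 0 \<preceq>\<^sub>L Sigma_rho A B C G \<rho> \<longrightarrow>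
           (\<forall>t. 0 \<prec>\<^sub>L P t \<and> P t \<preceq>\<^sub>L Sigma_rho A B C G \<rho>
              \<and> invertible (matrix_inv (P t) + transpose C ** C - \<theta> *\<^sub>R (transpose D ** D))
              \<and> invertible (matrix_inv (P t) - \<theta> *\<^sub>R (transpose D ** D))
              \<and> 0 \<prec>\<^sub>L matrix_inv (matrix_inv (P t) - \<theta> *\<^sub>R (transpose D ** D))))
    \<and> (P 0 = Sigma_rho A B C G \<rho> \<longrightarrow> (\<forall>t. P (Suc t) \<preceq>\<^sub>L P t))"
proof -
  define S where "S = Sigma_rho A B C G \<rho>"
  have \<rho>0: "0 < \<rho>" using assms(6) by simp
  have eq: "S = \<rho>\<^sup>2 *\<^sub>R ((A - G ** C) ** S ** transpose (A - G ** C)) + B ** transpose B + G ** transpose G"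
    unfolding S_def by (rule Sigma_rho_equation[OF assms(3) \<rho>0 assms(7)])
  have S: "pd S" unfolding S_def by (rule pd_Sigma_rho[OF assms(3) \<rho>0 assms(7)])
  (* Full row rank makes D S D^T definite, so the denominator of beta is positive. *)
  have "inj ((*v) (transpose D))"
    using assms(2) by (simp add: rank_transpose flip: full_rank_injective)
  then have "transpose D *v u \<noteq> 0" if "u \<noteq> 0" for u
    using that by (metis injD matrix_vector_mult_0_right)
  then have "pd (D ** S ** transpose D)"
    using S by (simp add: pd_def symmetric_mat_congruence inner_congruence)
  then have pos: "0 < lambda_max (D ** S ** transpose D)" (is "0 < ?l") by (rule lambda_max_pos)
  have \<theta>: "\<theta> * ((D *v z) \<bullet> (D *v z)) \<le> (1 - 1 / \<rho>\<^sup>2) * (z \<bullet> (matrix_inv S *v z))" for z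
  proof -
    have "\<theta> * ((D *v z) \<bullet> (D *v z)) \<le> \<theta> * (?l * (z \<bullet> (matrix_inv S *v z)))"
      by (intro mult_left_mono gram_le_lambda_max_inverse S pos assms(8))
    also have "\<dots> = (\<theta> * ?l) * (z \<bullet> (matrix_inv S *v z))" by simp
    also have "\<dots> \<le> (1 - 1 / \<rho>\<^sup>2) * (z \<bullet> (matrix_inv S *v z))"
    proof (rule mult_right_mono)
      have "\<theta> \<le> (\<rho>\<^sup>2 - 1) / (\<rho>\<^sup>2 * ?l)" using assms(9) by (simp add: beta_rho_def S_def)
      then show "\<theta> * ?l \<le> 1 - 1 / \<rho>\<^sup>2" using pos \<rho>0 by (simp add: field_simps)
    qed (rule pd_nonneg[OF pd_matrix_inv[OF S]])
    finally show ?thesis .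
  qed
  note bounds = riccati_information_bounds[OF S _ _ \<rho>0 \<theta>]
  have traj: "pd (P t) \<and> P t \<preceq>\<^sub>L S" if P0: "pd (P 0)" "P 0 \<preceq>\<^sub>L S" for t
  proof (induction t)
    case (Suc t)
    have pd: "pd (P (Suc t))"
      unfolding assms(10) using Suc by (intro pd_risk_riccati[OF assms(3)] bounds) auto
    have "x \<bullet> (P (Suc t) *v x) \<le> x \<bullet> (S *v x)" for x
      unfolding assms(10) using Suc by (intro risk_riccati_le[OF S _ _ \<rho>0 \<theta> eq]) auto
    with pd S show ?case by (simp add: loewner_le_iff_form pd_def)
  qed (use P0 in simp)
  have mono: "P (Suc t) \<preceq>\<^sub>L P t" if P0: "P 0 = S" for t
  proof -
    have "P 0 \<preceq>\<^sub>L S" using S by (simp add: P0 loewner_le_iff_form pd_def)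
    with traj P0 S have tr: "pd (P t)" "P t \<preceq>\<^sub>L S" for t by auto
    show ?thesis
    proof (induction t)
      case 0
      show ?case using tr(2)[of 1] by (simp add: P0)
    next
      case (Suc t)
      have "x \<bullet> (P (Suc (Suc t)) *v x) \<le> x \<bullet> (P (Suc t) *v x)" for x
        unfolding assms(10)[of "Suc t"] unfolding assms(10)[of t]
        using risk_riccati_mono[OF tr(1) tr(1) Suc bounds(3)[OF tr] bounds(3)[OF tr]]
        by (simp add: assms(10)[of t])
      with tr(1) show ?case by (simp add: loewner_le_iff_form pd_def)
    qed
  qed
  show ?thesis
    unfolding S_def[symmetric] loewner_less_zero_iff
  proof (intro conjI impI allI)
    fix t assume "pd (P 0) \<and> P 0 \<preceq>\<^sub>L S"
    then have P: "pd (P t)" "P t \<preceq>\<^sub>L S" using traj by blast+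
    show "pd (P t)" "P t \<preceq>\<^sub>L S" by (fact P)+
    show "invertible (matrix_inv (P t) + transpose C ** C - \<theta> *\<^sub>R (transpose D ** D))"
      by (rule pd_invertible[OF bounds(3)[OF P]])
    show "invertible (matrix_inv (P t) - \<theta> *\<^sub>R (transpose D ** D))"
      by (rule pd_invertible[OF bounds(2)[OF P]])
    show "pd (matrix_inv (matrix_inv (P t) - \<theta> *\<^sub>R (transpose D ** D)))"
      by (rule pd_matrix_inv[OF bounds(2)[OF P]])
  next
    fix t assume "P 0 = S"
    then show "P (Suc t) \<preceq>\<^sub>L P t" by (rule mono)
  qed
qed

end
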